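(* Let $(X, \|\cdot\|)$ be a real normed space of dimension at least $2$, and let $\lambda \in [0, 1]$. Then the following conditions are equivalent: (i) $\rho_{\lambda}(x, y) = \rho_{\lambda}(y, x)$ for all $x, y \in X$. (ii) The norm in $X$ comes from an inner product.
   Context: For a real normed space $X$ and $x,y\in X$, the norm derivatives are $\rho_{-}(x,y):=\|x\|\lim_{t\to 0^{-}}\frac{\|x+ty\|-\|x\|}{t}$ and $\rho_{+}(x,y):=\|x\|\lim_{t\to 0^{+}}\frac{\|x+ty\|-\|x\|}{t}$ (the limits exist by convexity of the norm). For $\lambda\in[0,1]$, $\rho_{\lambda}(x, y) := \lambda\rho_-(x,y) + (1 - \lambda)\rho_+(x,y)$. The norm comes from an inner product if there is a real inner product $\langle\cdot,\cdot\rangle$ on $X$ with $\|x\|^2=\langle x,x\rangle$ for all $x\in X$. *)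

theory Defs
  imports "HOL-Analysis.Analysis"
begin

definition rho_minus :: "'a::real_normed_vector \<Rightarrow> 'a \<Rightarrow> real" where
  "rho_minus x y = norm x * Lim (at_left 0) (\<lambda>t::real. (norm (x + t *\<^sub>R y) - norm x) / t)"

definition rho_plus :: "'a::real_normed_vector \<Rightarrow> 'a \<Rightarrow> real" where
  "rho_plus x y = norm x * Lim (at_right 0) (\<lambda>t::real. (norm (x + t *\<^sub>R y) - norm x) / t)"

definition rho :: "real \<Rightarrow> 'a::real_normed_vector \<Rightarrow> 'a \<Rightarrow> real" where
  "rho l x y = l * rho_minus x y + (1 - l) * rho_plus x y"

(* The class real_inner provides one fixed inner product per type, tied to that type's norm,
   so an arbitrary inner product on a normed space is described here as a predicate. *)
definition is_inner_product :: "('a::real_vector \<Rightarrow> 'a \<Rightarrow> real) \<Rightarrow> bool" where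
  "is_inner_product ip \<longleftrightarrow>
     bilinear ip \<and> (\<forall>x y. ip x y = ip y x) \<and> (\<forall>x. x \<noteq> 0 \<longrightarrow> 0 < ip x x)"

definition norm_from_inner_product :: "'a::real_normed_vector itself \<Rightarrow> bool" where
  "norm_from_inner_product _ \<longleftrightarrow>
     (\<exists>ip :: 'a \<Rightarrow> 'a \<Rightarrow> real. is_inner_product ip \<and> (\<forall>x. (norm x)\<^sup>2 = ip x x))"

end

theory Submission
  imports Defs
begin

text \<open>
  Suppose \<open>\<rho>\<close> is symmetric, and restrict half the squared norm to a line:
  \<open>f t = (norm (u + t v))\<^sup>2 / 2\<close>. Because the norm is convex, \<open>\<rho> (u + t v) v\<close> lies between the
  one-sided derivatives of \<open>f\<close> at \<open>t\<close>, so it is a subgradient of \<open>f\<close> there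
  (\<open>rho_subgradient\<close>). Symmetry moves the point of the line into the second argument, where its
  component along the first argument splits off (\<open>rho_add_self\<close>):
  \<open>\<rho> (u + t v) v = \<rho> v (u + t v) = \<rho> v u + t (norm v)\<^sup>2\<close>.
  A function with a subgradient that is affine in \<open>t\<close> is a quadratic polynomial
  (\<open>affine_subgradient_imp_quadratic\<close>), hence
  \<open>(norm (u + t v))\<^sup>2 = (norm u)\<^sup>2 + 2 t \<rho> v u + t\<^sup>2 (norm v)\<^sup>2\<close>
  for all vectors \<open>u\<close>, \<open>v\<close> and reals \<open>t\<close>.

  The values \<open>t = 1\<close> and \<open>t = -1\<close> give the parallelogram law, which makes \<open>\<rho>\<close> additive as in
  the theorem of Jordan and von Neumann; comparing the expansions for \<open>v\<close> and for \<open>t v\<close> makes it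
  homogeneous. So \<open>\<rho>\<close> itself is the inner product.

  Conversely, if the norm comes from an inner product, it is differentiable away from the origin,
  so that \<open>\<rho>\<^sub>-\<close>, \<open>\<rho>\<^sub>+\<close> and every weighted mean of them equal the inner product, which is
  symmetric.
\<close>

section \<open>One-sided derivatives of the norm\<close>

definition norm_slope :: "'a::real_normed_vector \<Rightarrow> 'a \<Rightarrow> real \<Rightarrow> real" where
  "norm_slope x y t = (norm (x + t *\<^sub>R y) - norm x) / t"

definition norm_deriv :: "'a::real_normed_vector \<Rightarrow> 'a \<Rightarrow> real" where
  "norm_deriv x y = Lim (at_right 0) (norm_slope x y)"

lemma norm_slope_mono:
  assumes "0 < s" "s \<le> t"
  shows "norm_slope x y s \<le> norm_slope x y t"
proof -
  \<comment> \<open>The point \<open>x + s y\<close> divides the segment from \<open>x\<close> to \<open>x + t y\<close> in the ratio \<open>s / t\<close>.\<close>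
  have "x + s *\<^sub>R y = (1 - s/t) *\<^sub>R x + (s/t) *\<^sub>R (x + t *\<^sub>R y)"
    using assms by (simp add: algebra_simps)
  then have "norm (x + s *\<^sub>R y) \<le> norm ((1 - s/t) *\<^sub>R x) + norm ((s/t) *\<^sub>R (x + t *\<^sub>R y))"
    by (metis norm_triangle_ineq)
  also have "\<dots> = (1 - s/t) * norm x + (s/t) * norm (x + t *\<^sub>R y)"
    using assms by (simp add: abs_of_nonneg)
  finally have "norm (x + s *\<^sub>R y) - norm x \<le> (s/t) * (norm (x + t *\<^sub>R y) - norm x)"
    by (simp add: algebra_simps)
  then show ?thesis
    using assms by (simp add: norm_slope_def field_simps)
qed

lemma norm_slope_ge:
  assumes "0 < t"
  shows "- norm y \<le> norm_slope x y t"
proof -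
  have "norm x - norm (t *\<^sub>R y) \<le> norm (x + t *\<^sub>R y)"
    by (rule norm_diff_ineq)
  then show ?thesis
    using assms by (simp add: norm_slope_def field_simps)
qed

text \<open>Slopes of a convex function decrease towards the base point, so their limit is their
  infimum; it is finite because the norm is Lipschitz.\<close>

lemma norm_slope_tendsto_norm_deriv: "(norm_slope x y \<longlongrightarrow> norm_deriv x y) (at_right 0)"
  and norm_deriv_le_norm_slope: "0 < t \<Longrightarrow> norm_deriv x y \<le> norm_slope x y t"
proof -
  define L where "L = Inf (norm_slope x y ` {0<..})"
  have bdd: "bdd_below (norm_slope x y ` {0<..})"
    by (rule bdd_belowI2[where m = "- norm y"]) (auto intro: norm_slope_ge)
  have L_le: "L \<le> norm_slope x y t" if "0 < t" for t
    unfolding L_def using that by (intro cInf_lower[OF _ bdd]) auto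
  have lim: "(norm_slope x y \<longlongrightarrow> L) (at_right 0)"
  proof (rule order_tendstoI)
    fix a assume "a < L"
    then have "a < norm_slope x y t" if "0 < t" for t
      using L_le[OF that] by linarith
    then show "\<forall>\<^sub>F t in at_right 0. a < norm_slope x y t"
      by (auto simp: eventually_at_right_field intro: exI[of _ 1])
  next
    fix a assume "L < a"
    then obtain s where s: "0 < s" "norm_slope x y s < a"
      unfolding L_def using cInf_less_iff[OF _ bdd, of a] by auto
    then have "norm_slope x y t < a" if "0 < t" "t < s" for t
      using norm_slope_mono[of t s x y] that by linarith
    then show "\<forall>\<^sub>F t in at_right 0. norm_slope x y t < a"
      using s by (auto simp: eventually_at_right_field)
  qed
  have "norm_deriv x y = L"
    unfolding norm_deriv_def by (rule tendsto_Lim[OF _ lim]) simp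
  with lim L_le show "(norm_slope x y \<longlongrightarrow> norm_deriv x y) (at_right 0)"
    and "0 < t \<Longrightarrow> norm_deriv x y \<le> norm_slope x y t"
    by auto
qed

lemma rho_plus_eq: "rho_plus x y = norm x * norm_deriv x y"
  unfolding rho_plus_def norm_deriv_def norm_slope_def ..

lemma rho_minus_eq: "rho_minus x y = - norm x * norm_deriv x (- y)"
proof -
  have "((\<lambda>t. - norm_slope x (- y) t) \<longlongrightarrow> - norm_deriv x (- y)) (at_right 0)"
    by (intro tendsto_minus norm_slope_tendsto_norm_deriv)
  then have "((\<lambda>t. (norm (x + t *\<^sub>R y) - norm x) / t) \<longlongrightarrow> - norm_deriv x (- y)) (at_left 0)"
    by (simp add: filterlim_at_left_to_right norm_slope_def)
  then have "Lim (at_left 0) (\<lambda>t::real. (norm (x + t *\<^sub>R y) - norm x) / t) = - norm_deriv x (- y)"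
    by (intro tendsto_Lim) simp_all
  then show ?thesis
    by (simp add: rho_minus_def)
qed

text \<open>The left derivative \<open>- norm_deriv x (- y)\<close> does not exceed the right one, by convexity at
  the midpoint \<open>x\<close> of \<open>x - t y\<close> and \<open>x + t y\<close>.\<close>

lemma norm_deriv_add_minus_nonneg: "0 \<le> norm_deriv x y + norm_deriv x (- y)"
proof (rule tendsto_lowerbound)
  show "((\<lambda>t. norm_slope x y t + norm_slope x (- y) t)
          \<longlongrightarrow> norm_deriv x y + norm_deriv x (- y)) (at_right 0)"
    by (intro tendsto_add norm_slope_tendsto_norm_deriv)
  have "0 \<le> norm_slope x y t + norm_slope x (- y) t" if "0 < t" for t
  proof -
    have "(x + t *\<^sub>R y) + (x + t *\<^sub>R (- y)) = 2 *\<^sub>R x"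
      by (simp add: scaleR_2)
    then have "2 * norm x \<le> norm (x + t *\<^sub>R y) + norm (x + t *\<^sub>R (- y))"
      using norm_triangle_ineq[of "x + t *\<^sub>R y" "x + t *\<^sub>R (- y)"] by simp
    then have "0 \<le> ((norm (x + t *\<^sub>R y) - norm x) + (norm (x + t *\<^sub>R (- y)) - norm x)) / t"
      using that by simp
    then show ?thesis
      unfolding norm_slope_def add_divide_distrib .
  qed
  then show "\<forall>\<^sub>F t in at_right 0. 0 \<le> norm_slope x y t + norm_slope x (- y) t"
    by (auto simp: eventually_at_right_field intro: exI[of _ 1])
qed simp

text \<open>Adding a multiple of \<open>x\<close> to the direction amounts to rescaling:
  \<open>x + t (y + a x) = (1 + t a) (x + s y)\<close> with \<open>s = t / (1 + t a)\<close>. Solving for \<open>t\<close> gives the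
  parameter \<open>s / (1 - s a)\<close> used below. Bounding one derivative by a slope of the other yields an
  inequality, and applying it to \<open>- a\<close> yields the converse.\<close>

lemma norm_deriv_add_self_le: "norm_deriv x (y + a *\<^sub>R x) \<le> norm_deriv x y + a * norm x"
proof (rule tendsto_lowerbound)
  show "((\<lambda>s. norm_slope x y s + a * norm x) \<longlongrightarrow> norm_deriv x y + a * norm x) (at_right 0)"
    by (intro tendsto_add norm_slope_tendsto_norm_deriv tendsto_const)
  have le: "norm_deriv x (y + a *\<^sub>R x) \<le> norm_slope x y s + a * norm x"
    if s: "0 < s" "0 < 1 - s * a" for s
  proof -
    define t where "t = s / (1 - s * a)"
    have t: "0 < t" and ts: "t = (1 + t * a) * s" and pos: "0 < 1 + t * a"
      using s by (auto simp: t_def field_simps)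
    have "x + t *\<^sub>R (y + a *\<^sub>R x) = (1 + t * a) *\<^sub>R x + ((1 + t * a) * s) *\<^sub>R y"
      using ts by (simp add: algebra_simps)
    then have "x + t *\<^sub>R (y + a *\<^sub>R x) = (1 + t * a) *\<^sub>R (x + s *\<^sub>R y)"
      by (simp add: scaleR_add_right)
    then have "norm (x + t *\<^sub>R (y + a *\<^sub>R x)) = (1 + t * a) * norm (x + s *\<^sub>R y)"
      using pos by simp
    then have "norm (x + t *\<^sub>R (y + a *\<^sub>R x)) - norm x
        = (1 + t * a) * (norm (x + s *\<^sub>R y) - norm x) + t * (a * norm x)"
      by (simp add: algebra_simps)
    then have "norm_slope x (y + a *\<^sub>R x) t
        = (1 + t * a) * (norm (x + s *\<^sub>R y) - norm x) / t + a * norm x"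
      using t by (simp add: norm_slope_def add_divide_distrib)
    also have "(1 + t * a) * (norm (x + s *\<^sub>R y) - norm x) / t = norm_slope x y s"
      using pos by (subst (2) ts) (simp add: norm_slope_def)
    finally show ?thesis
      using norm_deriv_le_norm_slope[OF t, of x "y + a *\<^sub>R x"] by simp
  qed
  have "\<forall>\<^sub>F s in at_right 0. 0 < 1 - s * a"
    by (rule order_tendstoD(1)[of _ 1]) (auto intro!: tendsto_eq_intros)
  moreover have "\<forall>\<^sub>F s in at_right (0::real). 0 < s"
    by (simp add: eventually_at_filter)
  ultimately show "\<forall>\<^sub>F s in at_right 0. norm_deriv x (y + a *\<^sub>R x) \<le> norm_slope x y s + a * norm x"
    by eventually_elim (rule le)
qed simp

lemma norm_deriv_add_self: "norm_deriv x (y + a *\<^sub>R x) = norm_deriv x y + a * norm x"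
  using norm_deriv_add_self_le[of x y a] norm_deriv_add_self_le[of x "y + a *\<^sub>R x" "- a"]
  by simp

section \<open>Subgradients of the squared norm\<close>

lemma rho_eq: "rho l x y = norm x * ((1 - l) * norm_deriv x y - l * norm_deriv x (- y))"
  by (simp add: rho_def rho_plus_eq rho_minus_eq algebra_simps)

lemma rho_add_self: "rho l x (y + a *\<^sub>R x) = rho l x y + a * (norm x)\<^sup>2"
proof -
  have minus: "norm_deriv x (- (y + a *\<^sub>R x)) = norm_deriv x (- y) - a * norm x"
    using norm_deriv_add_self[of x "- y" "- a"] by simp
  show ?thesis
    unfolding rho_eq minus norm_deriv_add_self by (simp add: algebra_simps power2_eq_square)
qed

text \<open>As a mean of the left and the right derivative of the norm, the weighted derivative \<open>d\<close> is a
  slope of a line supporting the norm along direction \<open>y\<close>. Squaring only improves the bound: with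
  \<open>a = norm x\<close> and \<open>b = norm (x + s y)\<close>, \<open>b\<^sup>2 - a\<^sup>2 = 2 a (b - a) + (b - a)\<^sup>2\<close>.\<close>

lemma rho_subgradient:
  assumes l: "0 \<le> l" "l \<le> 1"
  shows "(norm x)\<^sup>2 + 2 * s * rho l x y \<le> (norm (x + s *\<^sub>R y))\<^sup>2"
proof -
  define d where "d = (1 - l) * norm_deriv x y - l * norm_deriv x (- y)"
  have "norm_deriv x y - d = l * (norm_deriv x y + norm_deriv x (- y))"
    and "d + norm_deriv x (- y) = (1 - l) * (norm_deriv x y + norm_deriv x (- y))"
    by (simp_all add: d_def algebra_simps)
  moreover have "0 \<le> l * (norm_deriv x y + norm_deriv x (- y))"
    and "0 \<le> (1 - l) * (norm_deriv x y + norm_deriv x (- y))"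
    using l norm_deriv_add_minus_nonneg[of x y] by simp_all
  ultimately have d: "- norm_deriv x (- y) \<le> d" "d \<le> norm_deriv x y"
    by linarith+
  have "norm x + s * d \<le> norm (x + s *\<^sub>R y)"
  proof (cases s "0::real" rule: linorder_cases)
    case greater
    then have "d \<le> norm_slope x y s"
      using norm_deriv_le_norm_slope[of s x y] d by linarith
    then show ?thesis
      using greater by (simp add: norm_slope_def field_simps)
  next
    case less
    then have "- d \<le> norm_slope x (- y) (- s)"
      using norm_deriv_le_norm_slope[of "- s" x "- y"] d by linarith
    then show ?thesis
      using less by (simp add: norm_slope_def field_simps)
  qed simp
  then have "norm x * (s * d) \<le> norm x * (norm (x + s *\<^sub>R y) - norm x)"
    by (intro mult_left_mono) auto
  moreover have "(norm (x + s *\<^sub>R y))\<^sup>2 - (norm x)\<^sup>2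
      = 2 * (norm x * (norm (x + s *\<^sub>R y) - norm x)) + (norm (x + s *\<^sub>R y) - norm x)\<^sup>2"
    by (simp add: power2_eq_square algebra_simps)
  moreover have "s * rho l x y = norm x * (s * d)"
    by (simp add: rho_eq d_def)
  moreover have "0 \<le> (norm (x + s *\<^sub>R y) - norm x)\<^sup>2"
    by simp
  ultimately show ?thesis
    by linarith
qed

text \<open>The factor \<open>2\<close> makes \<open>b + t c\<close> a subgradient of \<open>f / 2\<close>, the scaling in which \<open>f\<close> is a
  squared norm. Subtracting the quadratic candidate from \<open>f\<close> leaves a function \<open>h\<close> for which the subgradient
  inequality reads \<open>h s - h t \<ge> - c (s - t)\<^sup>2\<close>. Exchanging \<open>s\<close> and \<open>t\<close> shows that the increments
  of \<open>h\<close> are of second order, so the derivative of \<open>h\<close> vanishes.\<close>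

lemma affine_subgradient_imp_quadratic:
  fixes f :: "real \<Rightarrow> real"
  assumes sub: "\<And>s t. f t + 2 * (s - t) * (b + t * c) \<le> f s"
  shows "f t = f 0 + 2 * t * b + t\<^sup>2 * c"
proof -
  define h where "h t = f t - 2 * t * b - t\<^sup>2 * c" for t
  have ge: "- (c * (s - t)\<^sup>2) \<le> h s - h t" for s t
    using sub[of t s] by (simp add: h_def power2_eq_square algebra_simps)
  have abs_le: "\<bar>h s - h t\<bar> \<le> c * (s - t)\<^sup>2" for s t
    using ge[of s t] ge[of t s] by (simp add: power2_commute abs_le_iff)
  have "(h has_real_derivative 0) (at t)" for t
    unfolding DERIV_def
  proof (rule Lim_null_comparison)
    have "\<bar>(h (t + e) - h t) / e\<bar> \<le> c * \<bar>e\<bar>" if "e \<noteq> 0" for e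
      using abs_le[of "t + e" t] that
      by (simp add: abs_divide divide_le_eq power2_eq_square mult.assoc)
    then show "\<forall>\<^sub>F e in at 0. norm ((h (t + e) - h t) / e) \<le> c * \<bar>e\<bar>"
      by (auto simp: eventually_at_filter)
    show "((\<lambda>e. c * \<bar>e\<bar>) \<longlongrightarrow> 0) (at 0)"
      by (auto intro!: tendsto_eq_intros)
  qed
  then have "h t = h 0"
    by (intro DERIV_isconst_all) blast
  then show ?thesis
    by (simp add: h_def)
qed

section \<open>From symmetry to an inner product\<close>

lemma norm_square_expansion:
  fixes u v :: "'a::real_normed_vector"
  assumes l: "0 \<le> l" "l \<le> 1"
    and sym: "\<And>x y :: 'a. rho l x y = rho l y x"
  shows "(norm (u + t *\<^sub>R v))\<^sup>2 = (norm u)\<^sup>2 + 2 * t * rho l u v + t\<^sup>2 * (norm v)\<^sup>2"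
proof -
  have "(norm (u + t *\<^sub>R v))\<^sup>2 + 2 * (s - t) * (rho l u v + t * (norm v)\<^sup>2)
      \<le> (norm (u + s *\<^sub>R v))\<^sup>2" for s t
  proof -
    have "rho l (u + t *\<^sub>R v) v = rho l u v + t * (norm v)\<^sup>2"
      using rho_add_self[of l v u t] sym by metis
    moreover have "u + t *\<^sub>R v + (s - t) *\<^sub>R v = u + s *\<^sub>R v"
      by (simp add: algebra_simps)
    ultimately show ?thesis
      using rho_subgradient[OF l, of "u + t *\<^sub>R v" "s - t" v] by metis
  qed
  from affine_subgradient_imp_quadratic[of "\<lambda>t. (norm (u + t *\<^sub>R v))\<^sup>2", OF this]
  show ?thesis by simp
qed

text \<open>In terms of the polar form \<open>((norm (u + v))\<^sup>2 - (norm u)\<^sup>2 - (norm v)\<^sup>2) / 2\<close>, this is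
  additivity in the second argument. Four parallelograms are chosen so that
  \<open>norm (x + y - z)\<close>, \<open>norm (x - y + z)\<close> and \<open>norm (y - z)\<close> cancel.\<close>

lemma parallelogram_imp_polar_additive:
  fixes x y z :: "'a::real_normed_vector"
  assumes par: "\<And>u v :: 'a. (norm (u + v))\<^sup>2 + (norm (u - v))\<^sup>2 = 2 * (norm u)\<^sup>2 + 2 * (norm v)\<^sup>2"
  shows "(norm (x + y + z))\<^sup>2
    = (norm (x + y))\<^sup>2 + (norm (y + z))\<^sup>2 + (norm (x + z))\<^sup>2
      - (norm x)\<^sup>2 - (norm y)\<^sup>2 - (norm z)\<^sup>2"
proof -
  have "(norm (x + y + z))\<^sup>2 + (norm (x + y - z))\<^sup>2 = 2 * (norm (x + y))\<^sup>2 + 2 * (norm z)\<^sup>2"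
    and "(norm (x + y - z))\<^sup>2 + (norm (x - y + z))\<^sup>2 = 2 * (norm x)\<^sup>2 + 2 * (norm (y - z))\<^sup>2"
    and "(norm (x + y + z))\<^sup>2 + (norm (x - y + z))\<^sup>2 = 2 * (norm (x + z))\<^sup>2 + 2 * (norm y)\<^sup>2"
    and "(norm (y + z))\<^sup>2 + (norm (y - z))\<^sup>2 = 2 * (norm y)\<^sup>2 + 2 * (norm z)\<^sup>2"
    using par[of "x + y" z] par[of x "y - z"] par[of "x + z" y] par[of y z]
    by (simp_all add: algebra_simps)
  then show ?thesis by linarith
qed

lemma symmetric_rho_imp_inner_product:
  assumes l: "0 \<le> l" "l \<le> 1"
    and sym: "\<And>x y :: 'a::real_normed_vector. rho l x y = rho l y x"
  shows "is_inner_product (rho l :: 'a \<Rightarrow> 'a \<Rightarrow> real)"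
    and "(norm (x :: 'a))\<^sup>2 = rho l x x"
proof -
  note expansion = norm_square_expansion[OF l sym]
  have norm_add: "(norm (u + v))\<^sup>2 = (norm u)\<^sup>2 + 2 * rho l u v + (norm v)\<^sup>2" for u v :: 'a
    using expansion[of u 1 v] by simp
  have norm_diff: "(norm (u - v))\<^sup>2 = (norm u)\<^sup>2 - 2 * rho l u v + (norm v)\<^sup>2" for u v :: 'a
    using expansion[of u "- 1" v] by simp
  have additive: "rho l u (v + w) = rho l u v + rho l u w" for u v w :: 'a
    using parallelogram_imp_polar_additive[of u v w]
      norm_add[of u v] norm_add[of u w] norm_add[of u "v + w"]
    by (simp add: norm_add norm_diff add.assoc)
  have homogeneous: "rho l u (t *\<^sub>R v) = t * rho l u v" for u v :: 'a and t
    using expansion[of u t v] norm_add[of u "t *\<^sub>R v"] by (simp add: power_mult_distrib)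
  have norm_eq: "(norm x)\<^sup>2 = rho l x x" for x :: 'a
    using expansion[of x "- 1" x] by simp
  have "linear (rho l u)" for u :: 'a
    by (rule linearI) (simp_all add: additive homogeneous)
  moreover from this have "linear (\<lambda>x. rho l x v)" for v :: 'a
    using sym[of _ v] by simp
  ultimately have "bilinear (rho l :: 'a \<Rightarrow> 'a \<Rightarrow> real)"
    by (simp add: bilinear_def)
  then show "is_inner_product (rho l :: 'a \<Rightarrow> 'a \<Rightarrow> real)"
    using sym by (simp add: is_inner_product_def flip: norm_eq)
  show "(norm x)\<^sup>2 = rho l x x"
    by (rule norm_eq)
qed

section \<open>Norm derivatives of an inner product norm\<close>

lemma inner_product_imp_norm_deriv:
  fixes x y :: "'a::real_normed_vector"
  assumes ip: "is_inner_product ip" and norm_eq: "\<And>x :: 'a. (norm x)\<^sup>2 = ip x x"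
    and x: "x \<noteq> 0"
  shows "norm_deriv x y = ip x y / norm x"
proof -
  have bil: "bilinear ip" and sym: "\<And>x y. ip x y = ip y x"
    using ip by (auto simp: is_inner_product_def)
  define N where "N t = sqrt ((norm x)\<^sup>2 + 2 * t * ip x y + t\<^sup>2 * (norm y)\<^sup>2)" for t
  have N: "norm (x + t *\<^sub>R y) = N t" for t
  proof -
    have "(norm (x + t *\<^sub>R y))\<^sup>2 = (norm x)\<^sup>2 + 2 * t * ip x y + t\<^sup>2 * (norm y)\<^sup>2"
      unfolding norm_eq using sym[of y x]
      by (simp add: bilinear_ladd[OF bil] bilinear_radd[OF bil] bilinear_lmul[OF bil]
          bilinear_rmul[OF bil] power2_eq_square algebra_simps)
    then show ?thesis
      unfolding N_def by (metis norm_ge_zero real_sqrt_unique)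
  qed
  have "(N has_real_derivative ip x y / norm x) (at 0)"
    unfolding N_def using x by (auto intro!: derivative_eq_intros simp: field_simps)
  then have "((\<lambda>t. (N t - N 0) / t) \<longlongrightarrow> ip x y / norm x) (at 0)"
    by (simp add: DERIV_def)
  then have "(norm_slope x y \<longlongrightarrow> ip x y / norm x) (at_right 0)"
    unfolding norm_slope_def N by (auto simp: N_def intro: tendsto_mono[OF at_le])
  then show ?thesis
    unfolding norm_deriv_def by (intro tendsto_Lim) simp_all
qed

lemma inner_product_imp_rho_eq:
  fixes x y :: "'a::real_normed_vector"
  assumes ip: "is_inner_product ip" and norm_eq: "\<And>x :: 'a. (norm x)\<^sup>2 = ip x x"
  shows "rho l x y = ip x y"
proof -
  have bil: "bilinear ip"
    using ip by (auto simp: is_inner_product_def)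
  show ?thesis
  proof (cases "x = 0")
    case True
    then show ?thesis
      by (simp add: rho_eq bilinear_lzero[OF bil])
  next
    case False
    then show ?thesis
      by (simp add: rho_eq inner_product_imp_norm_deriv[OF ip norm_eq False]
          bilinear_rneg[OF bil] field_simps)
  qed
qed

theorem theorem2p16:
  fixes l :: real
  assumes dim: "\<exists>B :: 'a::real_normed_vector set. independent B \<and> card B = 2"
    and l: "0 \<le> l" "l \<le> 1"
  shows "(\<forall>x y :: 'a. rho l x y = rho l y x) \<longleftrightarrow> norm_from_inner_product TYPE('a)"
proof
  assume "\<forall>x y :: 'a. rho l x y = rho l y x"
  then have sym: "\<And>x y :: 'a. rho l x y = rho l y x"
    by blast
  show "norm_from_inner_product TYPE('a)"
    unfolding norm_from_inner_product_def
    using symmetric_rho_imp_inner_product[OF l sym] by blast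
next
  assume "norm_from_inner_product TYPE('a)"
  then obtain ip :: "'a \<Rightarrow> 'a \<Rightarrow> real"
    where ip: "is_inner_product ip" and norm_eq: "\<And>x. (norm x)\<^sup>2 = ip x x"
    by (auto simp: norm_from_inner_product_def)
  show "\<forall>x y :: 'a. rho l x y = rho l y x"
    using ip by (simp add: inner_product_imp_rho_eq[OF ip norm_eq] is_inner_product_def)
qed

end
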